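(* Assume $X$ has finite variation, i.e. $\sigma=0$ and $\int_{|x|\le1}|x|\nu(dx)<\infty$, and that $d_+>0$. Then $$\lim_{t\to T}\frac{1}{T-t}\Big(\frac{K}{b_e(t)}-1\Big)=\int(e^y-1)_-\,\nu(dy).$$
   Context: Let $X$ be a real Lévy process with characteristic triplet $(\sigma^2,\gamma,\nu)$. Fix $T>0$, $K>0$, $r>0$, $\delta\ge0$. Assume $\int_{|x|\ge1}e^x\nu(dx)<\infty$ and $\frac{\sigma^2}{2}+\gamma+\int(e^x-1-x\mathbf 1_{|x|\le1})\nu(dx)=0$, and the non-degeneracy condition: $\sigma\neq0$, or $\nu((-\infty,0))>0$, or $\int_{(0,\infty)}(x\wedge1)\nu(dx)=\infty$. For $x\ge0$ let $S^x_t=xe^{(r-\delta)t+X_t}$ and $P_e(t,x)=\mathbb E[e^{-r(T-t)}(K-S^x_{T-t})_+]$ (European put). The European critical price is $b_e(t)=\inf\{x\ge0: P_e(t,x)>(K-x)_+\}$, $t\in[0,T)$; it is the unique $x\in(0,K)$ with $P_e(t,x)=K-x$. Let $d_+=r-\delta-\int(e^y-1)_+\nu(dy)$, and $(u)_-=\max(-u,0)$. *)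

theory Defs
  imports "HOL-Probability.Probability"
begin

definition levy_measure :: "real measure \<Rightarrow> bool" where
  "levy_measure \<nu> \<longleftrightarrow> sets \<nu> = sets borel \<and> emeasure \<nu> {0} = 0 \<and>
     (\<integral>\<^sup>+ x. ennreal (min 1 (x\<^sup>2)) \<partial>\<nu>) < \<infinity>"

definition lk_exponent :: "real \<Rightarrow> real \<Rightarrow> real measure \<Rightarrow> real \<Rightarrow> complex" where
  "lk_exponent \<sigma> \<gamma> \<nu> u =
     - complex_of_real (\<sigma>\<^sup>2 * u\<^sup>2 / 2) + \<i> * complex_of_real (\<gamma> * u)
     + (CLINT x|\<nu>. iexp (u * x) - 1 - \<i> * complex_of_real (u * x * indicator {-1..1} x))"

text \<open>mu is the law of X_s for a Levy process X with triplet (sigma^2,gamma,nu).\<close>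
definition levy_marginal :: "real \<Rightarrow> real \<Rightarrow> real measure \<Rightarrow> real \<Rightarrow> real measure \<Rightarrow> bool" where
  "levy_marginal \<sigma> \<gamma> \<nu> s \<mu> \<longleftrightarrow> prob_space \<mu> \<and> sets \<mu> = sets borel \<and>
     (\<forall>u. char \<mu> u = exp (complex_of_real s * lk_exponent \<sigma> \<gamma> \<nu> u))"

text \<open>European put price P_e(t,x), given the marginal laws mu s of X_s.\<close>
definition euro_put :: "(real \<Rightarrow> real measure) \<Rightarrow> real \<Rightarrow> real \<Rightarrow> real \<Rightarrow> real \<Rightarrow> real \<Rightarrow> real \<Rightarrow> real" where
  "euro_put \<mu> r \<delta> K T t x =
     (LINT y|\<mu> (T - t). exp (- r * (T - t)) * max 0 (K - x * exp ((r - \<delta>) * (T - t) + y)))"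

definition euro_crit :: "(real \<Rightarrow> real measure) \<Rightarrow> real \<Rightarrow> real \<Rightarrow> real \<Rightarrow> real \<Rightarrow> real \<Rightarrow> real" where
  "euro_crit \<mu> r \<delta> K T t = Inf {x. 0 \<le> x \<and> euro_put \<mu> r \<delta> K T t x > max 0 (K - x)}"

end

theory Submission
  imports Defs
begin

text \<open>
  Put \<open>s = T - t\<close>, \<open>loss z = (1 - e\<^sup>z)\<^sub>+\<close>, \<open>c = \<integral> loss d\<nu>\<close>, and let \<open>Z\<^sub>s\<close> be \<open>X\<^sub>s\<close> without its drift. The
  martingale condition turns the drift of \<open>ln S\<close> into \<open>D = d\<^sub>+ + c > c\<close>. Hence at
  \<open>x = K / (1 + \<rho> s)\<close> with \<open>0 \<le> \<rho> < D\<close> the put is out of the money apart from jumps: its price is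
  \<open>K e\<^bsup>-rs\<^esup> E loss (a + Z\<^sub>s)\<close> with \<open>0 \<le> a \<le> D s\<close>, which is \<open>K c s + o(s)\<close>, whereas
  \<open>K - x = K \<rho> s + o(s)\<close>. As the price is convex in \<open>x\<close> and lies below \<open>K\<close> at \<open>x = 0\<close>, the critical
  price is above \<open>K / (1 + \<rho> s)\<close> for \<open>\<rho> > c\<close> and below it for \<open>\<rho> < c\<close>.

  The estimates for \<open>Z\<^sub>s\<close> come from approximating it in law by \<open>A + B\<close>, with independent random walks
  \<open>A \<le> 0\<close> and \<open>B \<ge> 0\<close> whose steps are rare jumps distributed as \<open>\<nu>\<close> off a neighbourhood of 0. Since
  \<open>loss\<close> and \<open>min \<eta> loss\<close> are subadditive, their expectations at \<open>Z\<^sub>s\<close> are at most \<open>s\<close> times their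
  \<open>\<nu>\<close>-integrals. Conversely \<open>E (1 - loss A) = E e\<^sup>A\<close> is multiplicative in the steps of \<open>A\<close>, and
  \<open>B\<close> can only undo a loss of \<open>A\<close> if both are nonzero, which costs \<open>s \<integral> min \<eta> loss d\<nu> + O(s\<^sup>2 / \<eta>)\<close>.
\<close>

subsection \<open>Convolution powers and the loss function\<close>

lemma real_distribution_convolution:
  assumes "real_distribution P" "real_distribution Q"
  shows "real_distribution (P \<star> Q)"
proof -
  interpret P: real_distribution P by fact
  interpret Q: real_distribution Q by fact
  interpret PQ: pair_prob_space P Q ..
  show ?thesis
    unfolding convolution_def by (intro PQ.real_distribution_distr) simp
qed

lemma integral_convolution:
  fixes f :: "real \<Rightarrow> 'b::{banach, second_countable_topology}"
  assumes "real_distribution P" "real_distribution Q"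
    and [measurable]: "f \<in> borel_measurable borel" and bound: "\<And>x. norm (f x) \<le> B"
  shows "(LINT z|(P \<star> Q). f z) = (LINT x|P. LINT y|Q. f (x + y))"
proof -
  interpret P: real_distribution P by fact
  interpret Q: real_distribution Q by fact
  interpret PQ: pair_prob_space P Q ..
  have "integrable (P \<Otimes>\<^sub>M Q) (\<lambda>(x, y). f (x + y))"
    by (rule PQ.integrable_const_bound[where B = B]) (auto simp: bound)
  then show ?thesis
    unfolding convolution_def by (simp add: integral_distr PQ.integral_fst split_beta')
qed

lemma char_convolution:
  assumes "real_distribution P" "real_distribution Q"
  shows "char (P \<star> Q) t = char P t * char Q t"
proof -
  have "char (P \<star> Q) t = (CLINT x|P. CLINT y|Q. iexp (t * (x + y)))"
    unfolding char_def
    by (rule integral_convolution[OF assms, where B = 1]) (auto simp del: of_real_mult)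
  then show ?thesis
    by (simp add: char_def ring_distribs exp_add)
qed

lemma AE_convolution_nonpos:
  assumes "real_distribution P" "real_distribution Q"
    and P: "AE x in P. x \<le> 0" and Q: "AE x in Q. x \<le> 0"
  shows "AE x in P \<star> Q. x \<le> 0"
proof -
  interpret P: real_distribution P by fact
  interpret Q: real_distribution Q by fact
  interpret PQ: pair_prob_space P Q ..
  have "AE x in P. AE y in Q. x + y \<le> 0"
    using P by eventually_elim (use Q in eventually_elim, simp)
  moreover have "{z \<in> space (P \<Otimes>\<^sub>M Q). fst z + snd z \<le> 0} \<in> sets (P \<Otimes>\<^sub>M Q)"
    by measurable
  ultimately have "AE z in P \<Otimes>\<^sub>M Q. fst z + snd z \<le> 0"
    by (intro PQ.AE_pair_measure) auto
  then show ?thesis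
    unfolding convolution_def by (subst AE_distr_iff) (auto simp: split_beta')
qed

primrec conv_power :: "real measure \<Rightarrow> nat \<Rightarrow> real measure" where
  "conv_power P 0 = return borel 0"
| "conv_power P (Suc m) = (P \<star> conv_power P m)"

lemma real_distribution_return: "real_distribution (return borel x)"
  unfolding real_distribution_def real_distribution_axioms_def by (auto intro: prob_space_return)

lemma real_distribution_conv_power:
  "real_distribution P \<Longrightarrow> real_distribution (conv_power P m)"
  by (induction m) (auto intro: real_distribution_convolution real_distribution_return)

lemma char_conv_power:
  assumes "real_distribution P"
  shows "char (conv_power P m) t = char P t ^ m"
proof (induction m)
  case 0
  show ?case by (simp add: char_def integral_return)
next
  case (Suc m)
  then show ?case
    by (simp add: char_convolution[OF assms real_distribution_conv_power[OF assms]])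
qed

text \<open>Integrate \<open>sub\<close> over \<open>y\<close> and then over \<open>x\<close>, using
  Fubini; the bound \<open>B\<close> makes every integral finite.\<close>

lemma integral_convolution_subadditive:
  fixes h :: "real \<Rightarrow> real"
  assumes P: "real_distribution P" and Q: "real_distribution Q"
    and h[measurable]: "h \<in> borel_measurable borel" and bound: "\<And>x. \<bar>h x\<bar> \<le> B"
    and sub: "\<And>x y. h (x + y) \<le> h x + h y"
  shows "(LINT z|(P \<star> Q). h z) \<le> (LINT x|P. h x) + (LINT y|Q. h y)"
proof -
  interpret P: real_distribution P by fact
  interpret Q: real_distribution Q by fact
  have iP: "integrable P h" and iQ: "integrable Q h" "integrable Q (\<lambda>y. h (x + y))" for x
    by (auto intro!: P.integrable_const_bound[where B = B] Q.integrable_const_bound[where B = B] simp: bound)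
  have inner: "(LINT y|Q. h (x + y)) \<le> h x + (LINT y|Q. h y)" for x
  proof -
    have "(LINT y|Q. h (x + y)) \<le> (LINT y|Q. h x + h y)"
      by (intro integral_mono iQ Bochner_Integration.integrable_add) (auto simp: sub)
    also have "\<dots> = h x + (LINT y|Q. h y)"
      using iQ by (simp add: Q.prob_space del: Q.space_eq_univ)
    finally show ?thesis .
  qed
  have "(LINT z|(P \<star> Q). h z) = (LINT x|P. LINT y|Q. h (x + y))"
    by (rule integral_convolution[OF P Q, where B = B]) (auto simp: bound)
  also have "\<dots> \<le> (LINT x|P. h x + (LINT y|Q. h y))"
  proof (intro integral_mono inner)
    show "integrable P (\<lambda>x. LINT y|Q. h (x + y))"
    proof (rule P.integrable_const_bound[where B = B])
      have "norm (LINT y|Q. h (x + y)) \<le> B" for x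
      proof -
        have "norm (LINT y|Q. h (x + y)) \<le> (LINT y|Q. norm (h (x + y)))"
          by (rule integral_norm_bound)
        also have "\<dots> \<le> (LINT y|Q. B)"
          using iQ by (intro integral_mono) (auto simp: bound)
        finally show ?thesis by (simp add: Q.prob_space del: Q.space_eq_univ)
      qed
      then show "AE x in P. norm (LINT y|Q. h (x + y)) \<le> B" by simp
    qed simp
  qed (use iP in simp)
  also have "\<dots> = (LINT x|P. h x) + (LINT y|Q. h y)"
    using iP by (simp add: P.prob_space del: P.space_eq_univ)
  finally show ?thesis .
qed

text \<open>Induction on the number of steps; \<open>h 0 = 0\<close> settles the walk without
  steps.\<close>

lemma integral_conv_power_subadditive:
  fixes h :: "real \<Rightarrow> real"
  assumes P: "real_distribution P"
    and [measurable]: "h \<in> borel_measurable borel" and bound: "\<And>x. \<bar>h x\<bar> \<le> B"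
    and sub: "\<And>x y. h (x + y) \<le> h x + h y" and "h 0 = 0"
  shows "(LINT z|conv_power P m. h z) \<le> real m * (LINT x|P. h x)"
proof (induction m)
  case 0
  show ?case using \<open>h 0 = 0\<close> by (simp add: integral_return)
next
  case (Suc m)
  have "(LINT z|conv_power P (Suc m). h z) \<le> (LINT x|P. h x) + (LINT z|conv_power P m. h z)"
    unfolding conv_power.simps
    by (rule integral_convolution_subadditive[OF P real_distribution_conv_power[OF P] _ bound sub]) simp
  with Suc show ?case by (simp add: algebra_simps)
qed

text \<open>The payoff of a put with strike \<open>K\<close> at spot \<open>K * exp z\<close> is
  \<open>K * loss z\<close>: the put payoff in units of the strike, as a function of the log-ratio
  of spot to strike.\<close>

definition loss :: "real \<Rightarrow> real" where
  "loss z = max 0 (1 - exp z)"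

lemma loss_nonneg [simp]: "0 \<le> loss z" and loss_le_1 [simp]: "loss z \<le> 1"
  by (auto simp: loss_def)

lemma loss_eq_0: "0 \<le> z \<Longrightarrow> loss z = 0"
  by (simp add: loss_def)

lemma loss_nonpos: "z \<le> 0 \<Longrightarrow> loss z = 1 - exp z"
  by (simp add: loss_def)

lemma continuous_loss: "isCont loss x"
  unfolding loss_def[abs_def] by (intro continuous_intros)

lemma borel_measurable_loss [measurable]: "loss \<in> borel_measurable borel"
  unfolding loss_def[abs_def] by measurable

lemma loss_antimono: "x \<le> y \<Longrightarrow> loss y \<le> loss x"
  using exp_le_cancel_iff[of x y] unfolding loss_def by linarith

text \<open>If one argument is nonnegative, monotonicity suffices. If both are negative, the claim
  is \<open>0 \<le> (1 - exp x) * (1 - exp y)\<close> multiplied out.\<close>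

lemma loss_subadditive: "loss (x + y) \<le> loss x + loss y"
proof -
  consider "0 \<le> x" | "0 \<le> y" | "x < 0" "y < 0" by linarith
  then show ?thesis
  proof cases
    case 1
    then have "loss (x + y) \<le> loss y" by (simp add: loss_antimono)
    then show ?thesis using loss_nonneg[of x] by linarith
  next
    case 2
    then have "loss (x + y) \<le> loss x" by (simp add: loss_antimono)
    then show ?thesis using loss_nonneg[of y] by linarith
  next
    case 3
    then have "0 \<le> (1 - exp x) * (1 - exp y)" by simp
    with 3 show ?thesis by (simp add: loss_nonpos exp_add algebra_simps)
  qed
qed

lemma min_loss_subadditive:
  "0 < \<eta> \<Longrightarrow> min \<eta> (loss (x + y)) \<le> min \<eta> (loss x) + min \<eta> (loss y)"
  using loss_subadditive[of x y] loss_nonneg[of x] loss_nonneg[of y] by linarith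

lemma loss_le: "loss z \<le> min 1 \<bar>z\<bar>"
  using exp_ge_add_one_self[of z] exp_gt_zero[of z] unfolding loss_def by linarith

text \<open>For \<open>z \<le> 0\<close> the quantity \<open>1 - loss z\<close> is
  \<open>exp z\<close>, so independence makes its expectation multiplicative over the steps. The
  sign is carried through the induction because this identity holds only there.\<close>

lemma integral_conv_power_loss:
  assumes P: "real_distribution P" and nonpos: "AE x in P. x \<le> 0"
  shows "(AE x in conv_power P m. x \<le> 0) \<and>
    (LINT x|conv_power P m. 1 - loss x) = (LINT x|P. 1 - loss x) ^ m"
proof (induction m)
  case 0
  show ?case
    unfolding conv_power.simps
    by (intro conjI, subst AE_return) (simp_all add: integral_return loss_eq_0)
next
  case (Suc m)
  let ?Q = "conv_power P m"
  have Q: "real_distribution ?Q" by (rule real_distribution_conv_power[OF P])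
  interpret P: real_distribution P by fact
  interpret Q: real_distribution ?Q by fact
  have "(LINT z|(P \<star> ?Q). 1 - loss z) = (LINT x|P. LINT y|?Q. 1 - loss (x + y))"
    by (rule integral_convolution[OF P Q, where B = 1]) auto
  also have "\<dots> = (LINT x|P. LINT y|?Q. (1 - loss x) * (1 - loss y))"
  proof (rule integral_cong_AE)
    show "AE x in P. (LINT y|?Q. 1 - loss (x + y)) = (LINT y|?Q. (1 - loss x) * (1 - loss y))"
      using nonpos
    proof eventually_elim
      case (elim x)
      have "AE y in ?Q. 1 - loss (x + y) = (1 - loss x) * (1 - loss y)"
        using Suc[THEN conjunct1]
        by eventually_elim (use elim in \<open>simp add: loss_nonpos exp_add\<close>)
      then show ?case by (intro integral_cong_AE) auto
    qed
  qed auto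
  also have "\<dots> = (LINT x|P. 1 - loss x) * (LINT y|?Q. 1 - loss y)"
    by simp
  finally show ?case
    using Suc AE_convolution_nonpos[OF P Q nonpos] unfolding conv_power.simps by simp
qed

subsection \<open>Laws of rare jumps\<close>

text \<open>This is the law \<open>q \<nu>\<bar>\<^sub>A + (1 - q \<nu>(A)) \<delta>\<^sub>0\<close>. The case \<open>\<nu>(A) = 0\<close> is separate because there
  \<open>uniform_measure \<nu> A\<close> is not a probability measure.\<close>

definition jump_law :: "real measure \<Rightarrow> real set \<Rightarrow> real \<Rightarrow> real measure" where
  "jump_law \<nu> A q = (if measure \<nu> A = 0 then return borel 0 else
     distr (measure_pmf (bernoulli_pmf (q * measure \<nu> A)) \<Otimes>\<^sub>M uniform_measure \<nu> A) borel
       (\<lambda>(b, x). if b then x else 0))"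

lemma prob_space_uniform_measure':
  assumes "emeasure \<nu> A < \<infinity>" "measure \<nu> A \<noteq> 0"
  shows "prob_space (uniform_measure \<nu> A)"
  using assms by (intro prob_space_uniform_measure) (auto simp: measure_def)

lemma real_distribution_jump_law:
  assumes [measurable_cong]: "sets \<nu> = sets borel" and "emeasure \<nu> A < \<infinity>"
  shows "real_distribution (jump_law \<nu> A q)"
proof (cases "measure \<nu> A = 0")
  case True
  then show ?thesis by (simp add: jump_law_def real_distribution_return)
next
  case False
  let ?B = "measure_pmf (bernoulli_pmf (q * measure \<nu> A))" and ?U = "uniform_measure \<nu> A"
  interpret U: prob_space ?U by (rule prob_space_uniform_measure'[OF assms(2) False])
  interpret B: prob_space ?B by (rule measure_pmf.prob_space_axioms)
  interpret pair_prob_space ?B ?U ..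
  have "(\<lambda>(b, x). if b then x else 0) \<in> borel_measurable (?B \<Otimes>\<^sub>M ?U)"
    by measurable
  then show ?thesis using False by (simp add: jump_law_def)
qed

text \<open>Condition on the Bernoulli flag. The form with increments \<open>g x - g 0\<close> shows
  that a step changes expectations by order \<open>q\<close>, and it covers a null \<open>A\<close>
  as well, since the integral then vanishes.\<close>

lemma integral_jump_law:
  fixes g :: "real \<Rightarrow> 'b::{banach, second_countable_topology}"
  assumes [measurable_cong]: "sets \<nu> = sets borel"
    and A[measurable]: "A \<in> sets borel" and fin: "emeasure \<nu> A < \<infinity>"
    and q: "0 \<le> q" "q * measure \<nu> A \<le> 1"
    and g[measurable]: "g \<in> borel_measurable borel" and bound: "\<And>x. norm (g x) \<le> B"
  shows "(LINT x|jump_law \<nu> A q. g x) = g 0 + q *\<^sub>R (LINT x|\<nu>. indicator A x *\<^sub>R (g x - g 0))"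
proof (cases "measure \<nu> A = 0")
  case True
  have A': "A \<in> sets \<nu>" using A assms(1) by simp
  have "emeasure \<nu> A = 0"
    using fin True by (simp add: emeasure_eq_ennreal_measure)
  then have "AE x in \<nu>. x \<notin> A"
    using A' by (intro AE_not_in null_setsI) auto
  then have "(LINT x|\<nu>. indicator A x *\<^sub>R (g x - g 0)) = (LINT x|\<nu>. 0)"
    by (intro integral_cong_AE) (auto elim!: eventually_mono)
  then show ?thesis using True by (simp add: jump_law_def integral_return)
next
  case False
  let ?p = "q * measure \<nu> A"
  let ?B = "measure_pmf (bernoulli_pmf ?p)" and ?U = "uniform_measure \<nu> A"
  interpret U: prob_space ?U by (rule prob_space_uniform_measure'[OF fin False])
  interpret B: prob_space ?B by (rule measure_pmf.prob_space_axioms)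
  interpret BU: pair_prob_space ?B ?U ..
  have A': "A \<in> sets \<nu>" using A assms(1) by simp
  have M: "emeasure \<nu> A = ennreal (measure \<nu> A)" "0 < measure \<nu> A"
    using fin False by (auto simp: emeasure_eq_ennreal_measure zero_less_measure_iff)
  \<comment> \<open>The density is restated as the \<open>ennreal\<close> image of a real function,
    the form that \<open>integral_density\<close> takes.\<close>
  have "?U = density \<nu> (\<lambda>x. ennreal (indicator A x / measure \<nu> A))"
    unfolding uniform_measure_def using M
    by (intro density_cong) (auto simp: divide_ennreal[symmetric] ennreal_indicator)
  then have intU: "(LINT x|?U. g x) = (1 / measure \<nu> A) *\<^sub>R (LINT x|\<nu>. indicator A x *\<^sub>R g x)"
    by (simp add: integral_density scaleR_scaleR[symmetric] divide_inverse_commute del: scaleR_scaleR)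
  have iA: "integrable \<nu> (indicator A :: real \<Rightarrow> real)"
    using A' fin by (intro integrable_real_indicator) auto
  have ig: "integrable \<nu> (\<lambda>x. indicator A x *\<^sub>R g x)"
  proof (rule Bochner_Integration.integrable_bound)
    show "integrable \<nu> (\<lambda>x. B * indicator A x)" using iA by simp
    show "AE x in \<nu>. norm (indicator A x *\<^sub>R g x) \<le> norm (B * indicator A x)"
      using bound by (auto simp: indicator_def intro: order_trans[OF _ abs_ge_self])
  qed simp
  have diff: "(LINT x|\<nu>. indicator A x *\<^sub>R (g x - g 0))
      = (LINT x|\<nu>. indicator A x *\<^sub>R g x) - measure \<nu> A *\<^sub>R g 0"
    using ig iA A' by (simp add: scaleR_diff_right)
  have "(LINT x|jump_law \<nu> A q. g x) = (LINT z|(?B \<Otimes>\<^sub>M ?U). (case z of (b, x) \<Rightarrow> if b then g x else g 0))"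
    using False by (simp add: jump_law_def integral_distr split_beta' if_distrib[of g])
  also have "\<dots> = (LINT b|?B. LINT x|?U. (if b then g x else g 0))"
    by (rule BU.integral_fst[symmetric], rule BU.integrable_const_bound[where B = B]) (auto simp: bound)
  also have "\<dots> = ?p *\<^sub>R (LINT x|?U. g x) + (1 - ?p) *\<^sub>R g 0"
    using q U.prob_space by (subst integral_measure_pmf[where A = UNIV]) (auto simp: UNIV_bool)
  also have "\<dots> = g 0 + q *\<^sub>R (LINT x|\<nu>. indicator A x *\<^sub>R (g x - g 0))"
    using M unfolding diff intU by (simp add: algebra_simps)
  finally show ?thesis .
qed

text \<open>\<open>exp (w n)\<close> is the \<open>m n\<close>-th power of
  \<open>exp (w n / m n)\<close>. Both bases lie in the unit disc, by \<open>le1\<close> and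
  \<open>Re\<close>, so the powers differ by at most \<open>m n\<close> times the difference of the
  bases, which is of order \<open>1 / (m n)\<^sup>2\<close>.\<close>

lemma power_one_plus_tendsto_exp:
  fixes w :: "nat \<Rightarrow> complex"
  assumes w: "w \<longlonglongrightarrow> z" and m: "filterlim m at_top sequentially"
    and le1: "\<And>n. norm (1 + w n / of_nat (m n)) \<le> 1" and Re: "\<And>n. Re (w n) \<le> 0"
    and pos: "\<And>n. 0 < m n"
  shows "(\<lambda>n. (1 + w n / of_nat (m n)) ^ m n) \<longlonglongrightarrow> exp z"
proof -
  let ?v = "\<lambda>n. w n / of_nat (m n)"
  have rm: "filterlim (\<lambda>n. real (m n)) at_top sequentially"
    using filterlim_compose[OF filterlim_real_sequentially m] by simp
  have bound: "norm (exp (w n) - (1 + ?v n) ^ m n) \<le> exp (norm (w n)) * (norm (w n))\<^sup>2 / real (m n)" for n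
  proof -
    have nv: "norm (?v n) \<le> norm (w n)"
      using pos[of n] by (simp add: norm_divide divide_le_eq mult_le_cancel_left1)
    have "norm (exp (?v n)) \<le> 1"
      using Re[of n] pos[of n] by (simp add: norm_exp_eq_Re divide_nonpos_nonneg)
    moreover have "exp (w n) = exp (?v n) ^ m n"
      using pos[of n] by (simp add: exp_of_nat_mult[symmetric])
    ultimately have "norm (exp (w n) - (1 + ?v n) ^ m n) \<le> m n * norm (exp (?v n) - (1 + ?v n))"
      using le1[of n] by (simp add: norm_power_diff)
    also have "\<dots> \<le> m n * (exp (norm (?v n)) * (norm (?v n))\<^sup>2)"
      using Taylor_exp_field[of "?v n" 1] by (intro mult_left_mono) (auto simp: power2_eq_square)
    also have "\<dots> \<le> m n * (exp (norm (w n)) * (norm (?v n))\<^sup>2)"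
      using nv by (intro mult_left_mono mult_right_mono) auto
    also have "\<dots> = exp (norm (w n)) * (norm (w n))\<^sup>2 / real (m n)"
      using pos[of n] by (simp add: norm_divide power_divide power2_eq_square)
    finally show ?thesis .
  qed
  have "(\<lambda>n. exp (norm (w n)) * (norm (w n))\<^sup>2 / real (m n)) \<longlonglongrightarrow> 0"
    by (intro tendsto_divide_0[OF _ filterlim_at_top_imp_at_infinity[OF rm],
          where c = "exp (norm z) * (norm z)\<^sup>2"] tendsto_intros w)
  then have "(\<lambda>n. exp (w n) - (1 + ?v n) ^ m n) \<longlonglongrightarrow> 0"
    by (rule Lim_null_comparison[rotated]) (simp add: bound)
  from tendsto_diff[OF tendsto_exp[OF w] this] show ?thesis by simp
qed

subsection \<open>Random walk approximation of a driftless law\<close>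

text \<open>The bound linear in \<open>y\<close> serves small \<open>x\<close>, the bound 2 serves
  large \<open>x\<close>, and the constant covers both. Later \<open>y\<close> is \<open>x\<close>,
  \<open>min 0 x\<close> or \<open>max 0 x\<close>.\<close>

lemma norm_iexp_minus_1_le:
  assumes "\<bar>y\<bar> \<le> \<bar>x\<bar>"
  shows "norm (iexp (u * y) - 1) \<le> (2 + \<bar>u\<bar>) * min 1 \<bar>x\<bar>"
proof -
  have 1: "norm (iexp (u * y) - 1) \<le> \<bar>u\<bar> * \<bar>y\<bar>"
    using iexp_approx1[of "u * y" 0] by (simp add: abs_mult)
  have 2: "norm (iexp (u * y) - 1) \<le> 2"
    using iexp_approx2[of "u * y" 0] by simp
  show ?thesis
  proof (cases "\<bar>x\<bar> \<le> 1")
    case True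
    have "\<bar>u\<bar> * \<bar>y\<bar> \<le> (2 + \<bar>u\<bar>) * \<bar>x\<bar>" using assms by (intro mult_mono) auto
    with 1 True show ?thesis by (simp add: min_def)
  next
    case False
    with 2 show ?thesis by (simp add: min_def)
  qed
qed

lemma integrable_min_1_dominated:
  fixes h :: "real \<Rightarrow> 'b::{banach, second_countable_topology}"
  assumes [measurable_cong]: "sets \<nu> = sets borel" and int: "integrable \<nu> (\<lambda>x. min 1 \<bar>x\<bar>)"
    and [measurable]: "h \<in> borel_measurable borel" and bound: "\<And>x. norm (h x) \<le> C * min 1 \<bar>x\<bar>"
  shows "integrable \<nu> h"
proof (rule Bochner_Integration.integrable_bound)
  show "integrable \<nu> (\<lambda>x. C * min 1 \<bar>x\<bar>)" using int by simp
  show "AE x in \<nu>. norm (h x) \<le> norm (C * min 1 \<bar>x\<bar>)"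
    using bound by (auto intro: order_trans[OF _ abs_ge_self])
qed measurable

text \<open>\<open>Z\<close> is the law at time \<open>s\<close> of a pure jump process: under
  finite variation the Levy-Khintchine integral converges without a compensator.\<close>

locale driftless_levy_law =
  fixes \<nu> :: "real measure" and s :: real and Z :: "real measure"
  assumes sets_\<nu> [measurable_cong, simp]: "sets \<nu> = sets borel"
    and small_jumps: "integrable \<nu> (\<lambda>x. min 1 \<bar>x\<bar>)"
    and s_pos: "0 < s"
    and distribution_Z: "real_distribution Z"
    and char_Z: "\<And>u. char Z u = exp (complex_of_real s * (CLINT x|\<nu>. iexp (u * x) - 1))"
begin

lemmas integrable_dominated = integrable_min_1_dominated[OF sets_\<nu> small_jumps]

definition big :: "nat \<Rightarrow> real set" where
  "big n = {x. 1 / (real n + 1) < \<bar>x\<bar>}"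

lemma big_measurable [measurable]: "big n \<in> sets borel"
  unfolding big_def by measurable

lemma emeasure_big: "emeasure \<nu> (big n) < \<infinity>"
proof -
  have "integrable \<nu> (indicator (big n) :: real \<Rightarrow> real)"
  \<comment> \<open>On \<open>big n\<close> both 1 and \<open>\<bar>x\<bar>\<close> are at least
    \<open>1 / (real n + 1)\<close>, whence the constant.\<close>
  proof (rule integrable_dominated[where C = "real n + 1"])
    show "norm (indicator (big n) x :: real) \<le> (real n + 1) * min 1 \<bar>x\<bar>" for x
      by (auto simp: big_def indicator_def min_def field_simps)
  qed simp
  then show ?thesis by (simp add: integrable_indicator_iff)
qed

lemma indicator_big_tendsto: "x \<noteq> 0 \<Longrightarrow> (\<lambda>n. indicator (big n) x :: real) \<longlonglongrightarrow> 1"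
proof -
  assume "x \<noteq> 0"
  have "(\<lambda>n. 1 / (real n + 1)) \<longlonglongrightarrow> 0"
    using LIMSEQ_inverse_real_of_nat by (simp add: inverse_eq_divide add.commute)
  then have "\<forall>\<^sub>F n in sequentially. 1 / (real n + 1) < \<bar>x\<bar>"
    using \<open>x \<noteq> 0\<close> by (intro order_tendstoD(2)[where y = 0]) auto
  then have "\<forall>\<^sub>F n in sequentially. indicator (big n) x = (1::real)"
    by eventually_elim (simp add: big_def)
  then show ?thesis by (simp add: tendsto_eventually)
qed

lemma integral_big_tendsto:
  fixes h :: "real \<Rightarrow> 'b::{banach, second_countable_topology}"
  assumes [measurable]: "h \<in> borel_measurable borel" and bound: "\<And>x. norm (h x) \<le> C * min 1 \<bar>x\<bar>"
  shows "(\<lambda>n. LINT x|\<nu>. indicator (big n) x *\<^sub>R h x) \<longlonglongrightarrow> (LINT x|\<nu>. h x)"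
proof (rule integral_dominated_convergence[where w = "\<lambda>x. norm (h x)"])
  show "integrable \<nu> (\<lambda>x. norm (h x))"
    using integrable_dominated[OF assms] by simp
  have "(\<lambda>n. indicator (big n) x *\<^sub>R h x) \<longlonglongrightarrow> h x" for x
  proof (cases "x = 0")
    \<comment> \<open>At 0 the indicator never becomes 1, but the bound forces
      \<open>h 0 = 0\<close>.\<close>
    case True
    then show ?thesis using bound[of 0] by simp
  next
    case False
    from tendsto_scaleR[OF indicator_big_tendsto[OF this] tendsto_const[of "h x"]]
    show ?thesis by simp
  qed
  then show "AE x in \<nu>. (\<lambda>n. indicator (big n) x *\<^sub>R h x) \<longlonglongrightarrow> h x" by simp
qed (auto simp: indicator_def)

text \<open>The first summand makes the jump probability \<open>s \<nu>(big n) / steps n\<close> at most 1, the second one makes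
  \<open>steps n\<close> tend to infinity even if \<open>\<nu>\<close> is finite.\<close>

definition steps :: "nat \<Rightarrow> nat" where
  "steps n = nat \<lceil>s * measure \<nu> (big n)\<rceil> + n + 1"

lemma steps_pos: "0 < steps n"
  by (simp add: steps_def)

lemma steps_ge: "s * measure \<nu> (big n) \<le> real (steps n)"
  unfolding steps_def using real_nat_ceiling_ge[of "s * measure \<nu> (big n)"] by simp

lemma steps_at_top: "filterlim steps at_top sequentially"
  by (rule filterlim_at_top_mono[OF filterlim_ident]) (simp add: steps_def)

text \<open>\<open>\<theta>\<close> will be \<open>min 0\<close> or \<open>max 0\<close>: it keeps
  the jumps of one sign and turns the others into no jump, so one jump law serves both
  walks.\<close>

definition step :: "(real \<Rightarrow> real) \<Rightarrow> nat \<Rightarrow> real measure" where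
  "step \<theta> n = distr (jump_law \<nu> (big n) (s / steps n)) borel \<theta>"

definition walk :: "(real \<Rightarrow> real) \<Rightarrow> nat \<Rightarrow> real measure" where
  "walk \<theta> n = conv_power (step \<theta> n) (steps n)"

lemma real_distribution_step:
  assumes "\<theta> \<in> borel_measurable borel"
  shows "real_distribution (step \<theta> n)"
proof -
  interpret J: real_distribution "jump_law \<nu> (big n) (s / steps n)"
    by (intro real_distribution_jump_law emeasure_big) simp
  show ?thesis unfolding step_def using assms by (intro J.real_distribution_distr) simp
qed

lemma real_distribution_walk:
  "\<theta> \<in> borel_measurable borel \<Longrightarrow> real_distribution (walk \<theta> n)"
  unfolding walk_def by (intro real_distribution_conv_power real_distribution_step)

lemma integral_step:
  fixes g :: "real \<Rightarrow> 'b::{banach, second_countable_topology}"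
  assumes [measurable]: "\<theta> \<in> borel_measurable borel" "g \<in> borel_measurable borel"
    and "\<theta> 0 = 0" and bound: "\<And>x. norm (g x) \<le> B"
  shows "(LINT x|step \<theta> n. g x) =
    g 0 + (s / steps n) *\<^sub>R (LINT x|\<nu>. indicator (big n) x *\<^sub>R (g (\<theta> x) - g 0))"
proof -
  interpret J: real_distribution "jump_law \<nu> (big n) (s / steps n)"
    by (intro real_distribution_jump_law emeasure_big) simp
  have "(LINT x|step \<theta> n. g x) = (LINT x|jump_law \<nu> (big n) (s / steps n). g (\<theta> x))"
    unfolding step_def by (subst integral_distr) auto
  also have "\<dots> = g (\<theta> 0) + (s / steps n) *\<^sub>R (LINT x|\<nu>. indicator (big n) x *\<^sub>R (g (\<theta> x) - g (\<theta> 0)))"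
  proof (rule integral_jump_law[where B = B])
    show "s / steps n * measure \<nu> (big n) \<le> 1"
      using steps_ge[of n] steps_pos[of n] by (simp add: divide_le_eq)
  qed (use s_pos bound emeasure_big in auto)
  finally show ?thesis using \<open>\<theta> 0 = 0\<close> by simp
qed

text \<open>The characteristic function of a step is \<open>1 + w n / steps n\<close>, where
  \<open>w n\<close> converges to the exponent by dominated convergence, so its
  \<open>steps n\<close>-th power converges to the exponential.\<close>

lemma char_walk_tendsto:
  assumes \<theta>[measurable]: "\<theta> \<in> borel_measurable borel" and contract: "\<And>x. \<bar>\<theta> x\<bar> \<le> \<bar>x\<bar>"
  shows "(\<lambda>n. char (walk \<theta> n) u) \<longlonglongrightarrow>
    exp (complex_of_real s * (CLINT x|\<nu>. iexp (u * \<theta> x) - 1))"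
proof -
  have \<theta>0: "\<theta> 0 = 0" using contract[of 0] by simp
  define w where
    "w n = complex_of_real s * (CLINT x|\<nu>. indicator (big n) x *\<^sub>R (iexp (u * \<theta> x) - 1))" for n
  have dom: "norm (iexp (u * \<theta> x) - 1) \<le> (2 + \<bar>u\<bar>) * min 1 \<bar>x\<bar>" for x
    by (rule norm_iexp_minus_1_le[OF contract])
  have w_lim: "w \<longlonglongrightarrow> complex_of_real s * (CLINT x|\<nu>. iexp (u * \<theta> x) - 1)"
    unfolding w_def[abs_def]
    by (intro tendsto_mult tendsto_const integral_big_tendsto[where C = "2 + \<bar>u\<bar>"] dom) simp
  have char_step: "char (step \<theta> n) u = 1 + w n / of_nat (steps n)" for n
    unfolding char_def w_def
    by (subst integral_step[where B = 1]) (auto simp: \<theta>0 scaleR_conv_of_real simp del: of_real_mult)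
  have "Re (w n) \<le> 0" for n
  proof -
    have int: "integrable \<nu> (\<lambda>x. indicator (big n) x *\<^sub>R (iexp (u * \<theta> x) - 1))"
    proof (rule integrable_dominated[where C = "2 + \<bar>u\<bar>"])
      show "norm (indicator (big n) x *\<^sub>R (iexp (u * \<theta> x) - 1)) \<le> (2 + \<bar>u\<bar>) * min 1 \<bar>x\<bar>" for x
        using dom[of x] by (cases "x \<in> big n") auto
    qed simp
    have "Re (CLINT x|\<nu>. indicator (big n) x *\<^sub>R (iexp (u * \<theta> x) - 1))
        = (LINT x|\<nu>. Re (indicator (big n) x *\<^sub>R (iexp (u * \<theta> x) - 1)))"
      using integral_Re[OF int] by simp
    \<comment> \<open>The real part of the integrand is \<open>cos (u * \<theta> x) - 1\<close> or
      0.\<close>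
    also have "\<dots> \<le> (LINT x|\<nu>. 0)"
      using integrable_Re[OF int] by (intro integral_mono) (auto simp: indicator_def Re_exp)
    finally show ?thesis using s_pos by (simp add: w_def mult_le_0_iff)
  qed
  moreover have "norm (1 + w n / of_nat (steps n)) \<le> 1" for n
    unfolding char_step[symmetric]
    by (rule real_distribution.cmod_char_le_1[OF real_distribution_step[OF \<theta>]])
  ultimately have "(\<lambda>n. (1 + w n / of_nat (steps n)) ^ steps n) \<longlonglongrightarrow>
      exp (complex_of_real s * (CLINT x|\<nu>. iexp (u * \<theta> x) - 1))"
    by (intro power_one_plus_tendsto_exp w_lim steps_at_top steps_pos)
  then show ?thesis
    unfolding walk_def by (simp add: char_conv_power real_distribution_step char_step)
qed

text \<open>Each step contributes \<open>s / steps n\<close> times the integral over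
  \<open>big n\<close>. The number of steps cancels, so the bound is uniform in
  \<open>n\<close>.\<close>

lemma integral_walk_subadditive:
  fixes h :: "real \<Rightarrow> real"
  assumes [measurable]: "\<theta> \<in> borel_measurable borel" "h \<in> borel_measurable borel"
    and contract: "\<And>x. \<bar>\<theta> x\<bar> \<le> \<bar>x\<bar>" and h: "\<And>x. 0 \<le> h x" "\<And>x. h x \<le> min 1 \<bar>x\<bar>"
    and sub: "\<And>x y. h (x + y) \<le> h x + h y"
  shows "(LINT x|walk \<theta> n. h x) \<le> s * (LINT x|\<nu>. h (\<theta> x))"
proof -
  have \<theta>0: "\<theta> 0 = 0" using contract[of 0] by simp
  have h0: "h 0 = 0" using h[of 0] by simp
  have h1: "\<bar>h x\<bar> \<le> 1" for x using h[of x] by simp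
  have dom: "norm (h (\<theta> x)) \<le> 1 * min 1 \<bar>x\<bar>" for x
    using h[of "\<theta> x"] contract[of x] by simp
  have int: "integrable \<nu> (\<lambda>x. h (\<theta> x))"
    by (rule integrable_dominated[OF _ dom]) simp
  have "(LINT x|walk \<theta> n. h x) \<le> steps n * (LINT x|step \<theta> n. h x)"
    unfolding walk_def
    by (rule integral_conv_power_subadditive[OF _ _ h1 sub h0]) (auto intro: real_distribution_step)
  also have "\<dots> = s * (LINT x|\<nu>. indicator (big n) x * h (\<theta> x))"
    using steps_pos[of n] by (subst integral_step[where B = 1]) (auto simp: h0 \<theta>0 h1)
  also have "\<dots> \<le> s * (LINT x|\<nu>. h (\<theta> x))"
    using s_pos int integrable_mult_indicator[of "big n" \<nu>, OF _ int]
    by (intro mult_left_mono integral_mono) (auto simp: indicator_def h)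
  finally show ?thesis .
qed

text \<open>All steps are nonpositive, so the mean of \<open>1 - loss\<close> is multiplicative and
  equals \<open>(1 - s * ?c / steps n) ^ steps n\<close>, which is at most
  \<open>exp (- s * ?c)\<close>.\<close>

lemma integral_walk_loss_ge:
  "1 - exp (- s * (LINT x|\<nu>. indicator (big n) x * loss x)) \<le> (LINT x|walk (min 0) n. loss x)"
proof -
  let ?c = "LINT x|\<nu>. indicator (big n) x * loss x"
  have dstep: "real_distribution (step (min 0) n)" by (rule real_distribution_step) simp
  interpret S: real_distribution "step (min 0) n" by (rule dstep)
  interpret W: real_distribution "walk (min 0) n" by (rule real_distribution_walk) simp
  interpret J: real_distribution "jump_law \<nu> (big n) (s / steps n)"
    by (intro real_distribution_jump_law emeasure_big) simp
  have "AE x in step (min 0) n. x \<le> 0"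
    unfolding step_def by (subst AE_distr_iff) auto
  note pow = integral_conv_power_loss[OF dstep this, of "steps n", THEN conjunct2]
  have "(LINT x|step (min 0) n. 1 - loss x) = 1 - s * ?c / steps n"
  proof -
    have "loss (min 0 x) = loss x" for x by (simp add: loss_def min_def)
    then show ?thesis
      by (subst integral_step[where B = 1]) (auto simp: loss_eq_0)
  qed
  with pow have eq: "(LINT x|walk (min 0) n. 1 - loss x) = (1 - s * ?c / steps n) ^ steps n"
    by (simp add: walk_def)
  \<comment> \<open>This ensures that \<open>1 - s * ?c / steps n\<close> is nonnegative, as the
    comparison of its power with the exponential requires.\<close>
  have "?c \<le> (LINT x|\<nu>. indicator (big n) x)"
    using emeasure_big[of n] loss_le_1
    by (intro integral_mono integrable_dominated[where C = 1] integrable_real_indicator)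
       (auto simp: indicator_def intro: order_trans[OF loss_le])
  then have "s * ?c \<le> s * measure \<nu> (big n)"
    using s_pos by simp
  then have "s * ?c \<le> steps n" using steps_ge[of n] by linarith
  from exp_ge_one_minus_x_over_n_power_n[OF this steps_pos] eq
  have "(LINT x|walk (min 0) n. 1 - loss x) \<le> exp (- s * ?c)" by simp
  moreover have "integrable (walk (min 0) n) loss"
    by (rule W.integrable_const_bound[where B = 1]) auto
  ultimately show ?thesis by (simp add: W.prob_space del: W.space_eq_univ)
qed

text \<open>The signs are separated into two independent walks so that the downward one keeps its
  product formula and the upward one can be treated as a perturbation.\<close>

definition approx :: "nat \<Rightarrow> real measure" where
  "approx n = (walk (min 0) n \<star> walk (max 0) n)"

text \<open>By Levy's continuity theorem it is enough that the characteristic functions converge,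
  and those of the two walks multiply.\<close>

lemma integral_approx_tendsto:
  fixes h :: "real \<Rightarrow> real"
  assumes "\<And>x. isCont h x" "\<And>x. \<bar>h x\<bar> \<le> B"
  shows "(\<lambda>n. LINT x|approx n. h x) \<longlonglongrightarrow> (LINT x|Z. h x)"
proof -
  have d: "real_distribution (walk (min 0) n)" "real_distribution (walk (max 0) n)" for n
    by (auto intro: real_distribution_walk)
  then have da: "real_distribution (approx n)" for n
    unfolding approx_def by (rule real_distribution_convolution)
  have "(\<lambda>n. char (approx n) u) \<longlonglongrightarrow> char Z u" for u
  proof -
    let ?m = "CLINT x|\<nu>. iexp (u * min 0 x) - 1" and ?p = "CLINT x|\<nu>. iexp (u * max 0 x) - 1"
    have int: "integrable \<nu> (\<lambda>x. iexp (u * min 0 x) - 1)" "integrable \<nu> (\<lambda>x. iexp (u * max 0 x) - 1)"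
      by (auto intro!: integrable_dominated[where C = "2 + \<bar>u\<bar>"] norm_iexp_minus_1_le
          simp del: of_real_mult)
    have "?m + ?p = (CLINT x|\<nu>. (iexp (u * min 0 x) - 1) + (iexp (u * max 0 x) - 1))"
      by (rule Bochner_Integration.integral_add[symmetric, OF int])
    \<comment> \<open>One of \<open>min 0 x\<close> and \<open>max 0 x\<close> is 0 and the other is
      \<open>x\<close>, so one summand vanishes.\<close>
    also have "\<dots> = (CLINT x|\<nu>. iexp (u * x) - 1)"
      by (intro Bochner_Integration.integral_cong) (auto simp: min_def max_def)
    finally have sum: "?m + ?p = (CLINT x|\<nu>. iexp (u * x) - 1)" .
    have "(\<lambda>n. char (walk (min 0) n) u * char (walk (max 0) n) u) \<longlonglongrightarrow>
        exp (complex_of_real s * ?m) * exp (complex_of_real s * ?p)"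
      by (intro tendsto_mult char_walk_tendsto) auto
    then show ?thesis
      unfolding approx_def char_convolution[OF d] char_Z sum[symmetric] by (simp add: exp_add ring_distribs)
  qed
  then have "weak_conv_m approx Z"
    by (intro levy_continuity da distribution_Z)
  then show ?thesis
    using assms by (intro weak_conv_imp_integral_bdd_continuous_conv[where B = B] da distribution_Z) auto
qed

end

subsection \<open>Expected loss at small times\<close>

context driftless_levy_law
begin

text \<open>The bounds for the walks are uniform in \<open>n\<close> and pass to the weak limit.
  \<open>zero\<close> removes the upward walk's contribution and makes \<open>h (min 0 x)\<close>
  equal to \<open>h x\<close>.\<close>

lemma integral_subadditive_le:
  fixes h :: "real \<Rightarrow> real"
  assumes cont: "\<And>x. isCont h x" and h: "\<And>x. 0 \<le> h x" "\<And>x. h x \<le> min 1 \<bar>x\<bar>"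
    and sub: "\<And>x y. h (x + y) \<le> h x + h y" and zero: "\<And>x. 0 \<le> x \<Longrightarrow> h x = 0"
  shows "(LINT x|Z. h x) \<le> s * (LINT x|\<nu>. h x)"
proof -
  have [measurable]: "h \<in> borel_measurable borel"
    using cont by (intro borel_measurable_continuous_onI continuous_at_imp_continuous_on) auto
  have h1: "\<bar>h x\<bar> \<le> 1" for x using h[of x] by simp
  have "(LINT x|approx n. h x) \<le> s * (LINT x|\<nu>. h x)" for n
  proof -
    have "(LINT x|approx n. h x) \<le> (LINT x|walk (min 0) n. h x) + (LINT x|walk (max 0) n. h x)"
      unfolding approx_def
      by (rule integral_convolution_subadditive[OF _ _ _ h1 sub]) (auto intro: real_distribution_walk)
    also have "\<dots> \<le> s * (LINT x|\<nu>. h (min 0 x)) + s * (LINT x|\<nu>. h (max 0 x))"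
      by (intro add_mono integral_walk_subadditive h sub) auto
    also have "(\<lambda>x. h (max 0 x)) = (\<lambda>x. 0)" by (auto simp: zero)
    also have "(\<lambda>x. h (min 0 x)) = h" by (auto simp: zero min_def)
    finally show ?thesis by simp
  qed
  then show ?thesis
    by (intro LIMSEQ_le_const2[OF integral_approx_tendsto[OF cont h1]]) auto
qed

lemma integral_loss_le: "(LINT x|Z. loss x) \<le> s * (LINT x|\<nu>. loss x)"
  by (intro integral_subadditive_le continuous_loss loss_le loss_subadditive loss_eq_0) auto

lemma integral_min_loss_le:
  assumes "0 < \<eta>"
  shows "(LINT x|Z. min \<eta> (loss x)) \<le> s * (LINT x|\<nu>. min \<eta> (loss x))"
proof (rule integral_subadditive_le)
  show "isCont (\<lambda>x. min \<eta> (loss x)) x" for x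
    using continuous_loss[of x] by (intro continuous_intros)
  show "min \<eta> (loss x) \<le> min 1 \<bar>x\<bar>" for x using loss_le[of x] by linarith
qed (use assms in \<open>auto simp: loss_eq_0 min_loss_subadditive\<close>)

text \<open>\<open>1 - exp (- s * c)\<close> bounds the mean loss of the downward walk
  \<open>A\<close>. The next term gives up the losses truncated at \<eta>; the last one bounds what
  the upward walk \<open>B\<close> can undo of larger losses, using independence. The estimate holds
  along the walks and passes to the limit.\<close>

lemma integral_loss_ge:
  assumes \<eta>: "0 < \<eta>"
  defines "c \<equiv> LINT x|\<nu>. loss x" and "k \<equiv> LINT x|\<nu>. loss (- x)"
  shows "1 - exp (- s * c) - s * (LINT x|\<nu>. min \<eta> (loss x)) - s * c * (s * k) / \<eta> \<le> (LINT x|Z. loss x)"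
proof -
  \<comment> \<open>A move \<open>b\<close> undoes at most \<open>loss (- b)\<close> of the loss at
    \<open>a\<close>. If \<open>loss a\<close> exceeds \<eta>, the factor
    \<open>loss a / \<eta>\<close> exceeds 1 and may be inserted; otherwise the left side is at most
    0.\<close>
  have pointwise: "loss a - min \<eta> (loss a) - loss a * loss (- b) / \<eta> \<le> loss (a + b)" for a b
  proof (cases "loss a \<le> \<eta>")
    case True
    moreover have "0 \<le> loss a * loss (- b) / \<eta>" using \<eta> by simp
    ultimately show ?thesis using loss_nonneg[of "a + b"] by linarith
  next
    case False
    then have "loss (- b) * 1 \<le> loss (- b) * (loss a / \<eta>)"
      using \<eta> by (intro mult_left_mono) auto
    then have "loss (- b) \<le> loss a * loss (- b) / \<eta>" by (simp add: mult.commute)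
    moreover have "loss a \<le> loss (a + b) + loss (- b)"
      using loss_subadditive[of "a + b" "- b"] by simp
    moreover have "0 \<le> min \<eta> (loss a)" using \<eta> by simp
    ultimately show ?thesis by linarith
  qed
  have lossm: "(\<lambda>x. loss (min 0 x)) = loss" by (auto simp: loss_def min_def)
  have bound: "1 - exp (- s * (LINT x|\<nu>. indicator (big n) x * loss x))
      - s * (LINT x|\<nu>. min \<eta> (loss x)) - s * c * (s * k) / \<eta> \<le> (LINT x|approx n. loss x)" for n
  proof -
    let ?P = "walk (min 0) n" and ?Q = "walk (max 0) n"
    have P: "real_distribution ?P" and Q: "real_distribution ?Q"
      by (auto intro: real_distribution_walk)
    interpret P: real_distribution ?P by (rule P)
    interpret Q: real_distribution ?Q by (rule Q)
    have iP: "integrable ?P loss" "integrable ?P (\<lambda>a. min \<eta> (loss a))"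
      using \<eta> by (auto intro!: P.integrable_const_bound[where B = 1] simp: min.coboundedI2)
    have iQ: "integrable ?Q (\<lambda>b. loss (- b))" "integrable ?Q (\<lambda>b. loss (a + b))" for a
      by (auto intro!: Q.integrable_const_bound[where B = 1])
    have u1: "(LINT a|?P. loss a) \<le> s * c"
      using integral_walk_subadditive[of "min 0" loss n] loss_le loss_subadditive
      by (simp add: lossm c_def)
    have u2: "(LINT a|?P. min \<eta> (loss a)) \<le> s * (LINT x|\<nu>. min \<eta> (loss x))"
    proof -
      have "(LINT a|?P. min \<eta> (loss a)) \<le> s * (LINT x|\<nu>. min \<eta> (loss (min 0 x)))"
        by (rule integral_walk_subadditive)
           (use \<eta> loss_le in \<open>auto simp: min_loss_subadditive intro: min.coboundedI2\<close>)
      then show ?thesis using lossm by (simp add: fun_eq_iff)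
    qed
    have u3: "(LINT b|?Q. loss (- b)) \<le> s * k"
    proof -
      have "(LINT b|?Q. loss (- b)) \<le> s * (LINT x|\<nu>. loss (- max 0 x))"
      proof (rule integral_walk_subadditive)
        show "loss (- x) \<le> min 1 \<bar>x\<bar>" for x using loss_le[of "- x"] by simp
        show "loss (- (x + y)) \<le> loss (- x) + loss (- y)" for x y
          using loss_subadditive[of "- x" "- y"] by simp
      qed auto
      also have "(\<lambda>x. loss (- max 0 x)) = (\<lambda>x. loss (- x))" by (auto simp: loss_def max_def)
      finally show ?thesis by (simp add: k_def)
    qed
    have "0 \<le> c" unfolding c_def by simp
    have "(LINT a|?P. loss a) * (LINT b|?Q. loss (- b)) \<le> s * c * (s * k)"
      using u1 u3 \<open>0 \<le> c\<close> s_pos by (intro mult_mono) auto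
    then have u4: "(LINT a|?P. loss a) * (LINT b|?Q. loss (- b)) / \<eta> \<le> s * c * (s * k) / \<eta>"
      using \<eta> by (intro divide_right_mono) auto
    have inner: "loss a - min \<eta> (loss a) - loss a * (LINT b|?Q. loss (- b)) / \<eta>
        \<le> (LINT b|?Q. loss (a + b))" for a
    proof -
      have "(LINT b|?Q. loss a - min \<eta> (loss a) - loss a * loss (- b) / \<eta>) \<le> (LINT b|?Q. loss (a + b))"
        using iQ by (intro integral_mono pointwise) auto
      then show ?thesis using iQ by (simp add: Q.prob_space del: Q.space_eq_univ)
    qed
    \<comment> \<open>The product in the pointwise bound has been integrated over \<open>b\<close>
      already, so the integral over \<open>a\<close> factors.\<close>
    have "(LINT a|?P. loss a) - (LINT a|?P. min \<eta> (loss a))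
        - (LINT a|?P. loss a) * (LINT b|?Q. loss (- b)) / \<eta>
        = (LINT a|?P. loss a - min \<eta> (loss a) - loss a * (LINT b|?Q. loss (- b)) / \<eta>)"
      using iP by simp
    also have "\<dots> \<le> (LINT a|?P. LINT b|?Q. loss (a + b))"
    proof (intro integral_mono inner)
      show "integrable ?P (\<lambda>a. LINT b|?Q. loss (a + b))"
      proof (rule P.integrable_const_bound[where B = 1])
        have "(LINT b|?Q. loss (a + b)) \<le> (LINT b|?Q. 1)" for a
          using iQ by (intro integral_mono) auto
        then show "AE a in ?P. norm (LINT b|?Q. loss (a + b)) \<le> 1"
          by (simp add: Q.prob_space del: Q.space_eq_univ)
      qed simp
    qed (use iP in auto)
    also have "\<dots> = (LINT x|approx n. loss x)"
      unfolding approx_def by (rule integral_convolution[OF P Q, where B = 1, symmetric]) auto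
    finally show ?thesis
      using u2 u4 integral_walk_loss_ge[of n] by linarith
  qed
  have "(\<lambda>n. LINT x|\<nu>. indicator (big n) x * loss x) \<longlonglongrightarrow> c"
    using integral_big_tendsto[of loss 1] loss_le by (simp add: c_def)
  then have "(\<lambda>n. 1 - exp (- s * (LINT x|\<nu>. indicator (big n) x * loss x))
      - s * (LINT x|\<nu>. min \<eta> (loss x)) - s * c * (s * k) / \<eta>)
    \<longlonglongrightarrow> 1 - exp (- s * c) - s * (LINT x|\<nu>. min \<eta> (loss x)) - s * c * (s * k) / \<eta>"
    by (intro tendsto_intros)
  moreover have "(\<lambda>n. LINT x|approx n. loss x) \<longlonglongrightarrow> (LINT x|Z. loss x)"
    by (rule integral_approx_tendsto[where B = 1]) (auto intro: continuous_loss)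
  ultimately show ?thesis
    by (rule LIMSEQ_le) (use bound in auto)
qed

lemma integrable_shifted_loss: "integrable Z (\<lambda>x. loss (a + x))"
proof -
  interpret Z: real_distribution Z by (rule distribution_Z)
  show ?thesis by (rule Z.integrable_const_bound[where B = 1]) auto
qed

lemma shifted_loss_le:
  assumes "0 \<le> a"
  shows "(LINT x|Z. loss (a + x)) \<le> s * (LINT x|\<nu>. loss x)"
proof -
  have "(LINT x|Z. loss (a + x)) \<le> (LINT x|Z. loss x)"
    using integrable_shifted_loss[of a] integrable_shifted_loss[of 0] assms
    by (intro integral_mono) (auto intro: loss_antimono)
  then show ?thesis using integral_loss_le by linarith
qed

text \<open>A shift by \<open>a \<le> \<eta>\<close> lowers the loss by at most
  \<open>min \<eta> (loss x)\<close>, since \<open>loss (- a) \<le> a\<close>. This adds a second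
  copy of the truncated term of \<open>integral_loss_ge\<close>, hence the factor 2.\<close>

lemma shifted_loss_ge:
  assumes a: "0 \<le> a" "a \<le> \<eta>" and \<eta>: "0 < \<eta>"
  defines "c \<equiv> LINT x|\<nu>. loss x" and "k \<equiv> LINT x|\<nu>. loss (- x)"
  shows "1 - exp (- s * c) - 2 * s * (LINT x|\<nu>. min \<eta> (loss x)) - s * c * (s * k) / \<eta>
    \<le> (LINT x|Z. loss (a + x))"
proof -
  interpret Z: real_distribution Z by (rule distribution_Z)
  have i: "integrable Z loss" "integrable Z (\<lambda>x. min \<eta> (loss x))"
    using \<eta> by (auto intro!: Z.integrable_const_bound[where B = 1] simp: min.coboundedI2)
  have "loss x - min \<eta> (loss x) \<le> loss (a + x)" for x
  proof -
    have "loss (- a) \<le> \<eta>" using loss_le[of "- a"] a by simp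
    moreover have "loss x \<le> loss (a + x) + loss (- a)" using loss_subadditive[of "a + x" "- a"] by simp
    ultimately show ?thesis using loss_nonneg[of "a + x"] by linarith
  qed
  then have "(LINT x|Z. loss x - min \<eta> (loss x)) \<le> (LINT x|Z. loss (a + x))"
    using i integrable_shifted_loss by (intro integral_mono) auto
  then have "(LINT x|Z. loss x) - (LINT x|Z. min \<eta> (loss x)) \<le> (LINT x|Z. loss (a + x))"
    using i by simp
  then show ?thesis
    using integral_min_loss_le[OF \<eta>] integral_loss_ge[OF \<eta>] unfolding c_def k_def by linarith
qed

end

text \<open>Dominated convergence along the cut-offs \<open>1 / (real n + 1)\<close>. It makes the
  truncation error an arbitrarily small multiple of \<open>s\<close>.\<close>

lemma min_loss_integral_small:
  assumes [measurable_cong, simp]: "sets \<nu> = sets borel" and int: "integrable \<nu> (\<lambda>x. min 1 \<bar>x\<bar>)"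
    and "0 < (e::real)"
  obtains \<eta> where "0 < \<eta>" "(LINT x|\<nu>. min \<eta> (loss x)) < e"
proof -
  have "(\<lambda>n. LINT x|\<nu>. min (1 / (real n + 1)) (loss x)) \<longlonglongrightarrow> (LINT x|\<nu>. 0)"
  proof (rule integral_dominated_convergence[OF _ _ int])
    have "(\<lambda>n. 1 / (real n + 1)) \<longlonglongrightarrow> 0"
      using LIMSEQ_inverse_real_of_nat by (simp add: inverse_eq_divide add.commute)
    then have "(\<lambda>n. min (1 / (real n + 1)) (loss x)) \<longlonglongrightarrow> 0" for x
      using tendsto_min[OF _ tendsto_const[of "loss x"]] by (force simp: min_absorb1)
    then show "AE x in \<nu>. (\<lambda>n. min (1 / (real n + 1)) (loss x)) \<longlonglongrightarrow> 0"
      by simp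
    show "AE x in \<nu>. norm (min (1 / (real n + 1)) (loss x)) \<le> min 1 \<bar>x\<bar>" for n
      using loss_le by (auto intro!: AE_I2 intro: min.coboundedI2)
  qed auto
  then have "\<forall>\<^sub>F n in sequentially. (LINT x|\<nu>. min (1 / (real n + 1)) (loss x)) < e"
    using \<open>0 < e\<close> by (intro order_tendstoD(2)) auto
  then obtain n where "(LINT x|\<nu>. min (1 / (real n + 1)) (loss x)) < e"
    by (auto simp: eventually_sequentially)
  then show ?thesis by (intro that[of "1 / (real n + 1)"]) auto
qed

subsection \<open>Put prices and the critical price\<close>

lemma integrable_put_payoff:
  assumes "prob_space M" and [measurable_cong]: "sets M = sets borel" and "0 \<le> x" "0 \<le> (K::real)"
  shows "integrable M (\<lambda>y. max 0 (K - x * exp (b + y)))"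
proof -
  interpret prob_space M by fact
  show ?thesis
    by (rule integrable_const_bound[where B = K]) (use assms in auto)
qed

text \<open>Convexity of the price on the segment from 0 to \<open>x\<close>, with the price at 0, a
  discounted \<open>K\<close>, bounded by \<open>K\<close>.\<close>

lemma euro_put_interpolate:
  assumes M: "prob_space (\<mu> (T - t))" "sets (\<mu> (T - t)) = sets borel"
    and "0 \<le> x" "0 \<le> K" "0 \<le> r" "t \<le> T" and \<theta>: "0 \<le> \<theta>" "\<theta> \<le> 1"
  shows "euro_put \<mu> r \<delta> K T t (\<theta> * x) \<le> (1 - \<theta>) * K + \<theta> * euro_put \<mu> r \<delta> K T t x"
proof -
  interpret prob_space "\<mu> (T - t)" by fact
  let ?e = "exp (- r * (T - t))" and ?w = "\<lambda>x y. max 0 (K - x * exp ((r - \<delta>) * (T - t) + y))"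
  have i: "integrable (\<mu> (T - t)) (?w x)" "integrable (\<mu> (T - t)) (?w (\<theta> * x))"
    using assms by (auto intro!: integrable_put_payoff)
  have e: "?e \<le> 1" using assms by simp
  have "?e * ?w (\<theta> * x) y \<le> (1 - \<theta>) * K + \<theta> * (?e * ?w x y)" for y
  proof -
    let ?v = "x * exp ((r - \<delta>) * (T - t) + y)"
    \<comment> \<open>The first fact handles the branch \<open>K - \<theta> * ?v\<close> of the
      payoff at \<open>\<theta> * x\<close>, the other two the branch 0.\<close>
    have "\<theta> * (K - ?v) \<le> \<theta> * max 0 (K - ?v)" "0 \<le> \<theta> * max 0 (K - ?v)" "0 \<le> (1 - \<theta>) * K"
      using \<theta> \<open>0 \<le> K\<close> by (auto intro: mult_left_mono)
    then have "?w (\<theta> * x) y \<le> (1 - \<theta>) * K + \<theta> * ?w x y"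
      by (simp add: algebra_simps)
    then have "?e * ?w (\<theta> * x) y \<le> ?e * ((1 - \<theta>) * K + \<theta> * ?w x y)"
      by (rule mult_left_mono) simp
    also have "\<dots> = ?e * ((1 - \<theta>) * K) + \<theta> * (?e * ?w x y)"
      by (simp add: algebra_simps)
    also have "\<dots> \<le> 1 * ((1 - \<theta>) * K) + \<theta> * (?e * ?w x y)"
      using e \<theta> \<open>0 \<le> K\<close> by (intro add_right_mono mult_right_mono) auto
    finally show ?thesis by simp
  qed
  then have "euro_put \<mu> r \<delta> K T t (\<theta> * x)
      \<le> (LINT y|\<mu> (T - t). (1 - \<theta>) * K + \<theta> * (?e * ?w x y))"
    unfolding euro_put_def using i by (intro integral_mono) auto
  also have "\<dots> = (1 - \<theta>) * K + \<theta> * euro_put \<mu> r \<delta> K T t x"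
    unfolding euro_put_def using i by (simp add: prob_space)
  finally show ?thesis .
qed

lemma euro_crit_le:
  assumes "0 \<le> x" "max 0 (K - x) < euro_put \<mu> r \<delta> K T t x"
  shows "euro_crit \<mu> r \<delta> K T t \<le> x"
  unfolding euro_crit_def using assms by (intro cInf_lower bdd_belowI[where m = 0]) auto

text \<open>The chord from value \<open>K\<close> at 0 to value \<open>K - x\<close> at
  \<open>x\<close> is the line \<open>K - y\<close>, so no \<open>y < x\<close> is priced above
  intrinsic value. The point \<open>z\<close> shows that the set is nonempty; the infimum of an
  empty set would be unspecified.\<close>

lemma euro_crit_ge:
  assumes M: "prob_space (\<mu> (T - t))" "sets (\<mu> (T - t)) = sets borel"
    and "0 < x" "0 \<le> K" "0 \<le> r" "t \<le> T"
    and put: "euro_put \<mu> r \<delta> K T t x \<le> K - x"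
    and ne: "0 \<le> z" "max 0 (K - z) < euro_put \<mu> r \<delta> K T t z"
  shows "x \<le> euro_crit \<mu> r \<delta> K T t"
  unfolding euro_crit_def
proof (rule cInf_greatest)
  fix y assume y: "y \<in> {x. 0 \<le> x \<and> max 0 (K - x) < euro_put \<mu> r \<delta> K T t x}"
  show "x \<le> y"
  proof (rule ccontr)
    assume "\<not> x \<le> y"
    with y \<open>0 < x\<close> have \<theta>: "0 \<le> y / x" "y / x \<le> 1" by auto
    have "euro_put \<mu> r \<delta> K T t (y / x * x) \<le> (1 - y / x) * K + y / x * euro_put \<mu> r \<delta> K T t x"
      using assms \<theta> by (intro euro_put_interpolate) auto
    also have "\<dots> \<le> (1 - y / x) * K + y / x * (K - x)"
      using \<theta> put by (intro add_left_mono mult_left_mono)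
    also have "\<dots> = K - y" using \<open>0 < x\<close> by (simp add: field_simps)
    finally show False using y \<open>0 < x\<close> by simp
  qed
qed (use ne in auto)

text \<open>The first summand is \<nu>-integrable by finite variation, the second by the exponential
  moment condition.\<close>

lemma abs_exp_minus_1_le:
  fixes x :: real
  shows "\<bar>exp x - 1\<bar> \<le> 2 * min 1 \<bar>x\<bar> + exp x * indicator {x. 1 \<le> \<bar>x\<bar>} x"
proof (cases "1 \<le> \<bar>x\<bar>")
  case True
  then show ?thesis using exp_gt_zero[of x] by (auto simp: abs_if)
next
  case False
  have "\<bar>exp x - 1\<bar> \<le> 2 * \<bar>x\<bar>"
  proof (cases "0 \<le> x")
    case True
    then have "exp x \<le> 1 + x + x\<^sup>2" using False by (intro exp_bound) auto
    moreover have "x\<^sup>2 \<le> x" using True False by (simp add: power2_eq_square mult_left_le)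
    ultimately show ?thesis using True by simp
  next
    case neg: False
    then have "exp x \<le> 1" by simp
    then show ?thesis using neg exp_ge_add_one_self[of x] by linarith
  qed
  then show ?thesis using False by simp
qed

text \<open>\<open>loss\<close> vanishes only on the nonnegative half-line, so a zero integral would
  make the negative half-line null.\<close>

lemma loss_integral_pos:
  assumes [measurable_cong, simp]: "sets \<nu> = sets borel" and int: "integrable \<nu> loss"
    and neg: "0 < emeasure \<nu> {..<0}"
  shows "0 < (LINT x|\<nu>. loss x)"
proof -
  have "\<not> (AE x in \<nu>. loss x = 0)"
  proof
    assume "AE x in \<nu>. loss x = 0"
    then have "AE x in \<nu>. x \<notin> {..<0}"
      by eventually_elim (auto simp: loss_def split: if_splits)
    then have "emeasure \<nu> {..<0} = 0"
      using sets_eq_imp_space_eq[OF assms(1)]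
      by (subst (asm) AE_iff_measurable[OF _ refl]) (auto simp: lessThan_def)
    with neg show False by simp
  qed
  then have "(LINT x|\<nu>. loss x) \<noteq> 0"
    using integral_nonneg_eq_0_iff_AE[OF int] by auto
  moreover have "0 \<le> (LINT x|\<nu>. loss x)" by simp
  ultimately show ?thesis by linarith
qed

text \<open>Under finite variation the compensator is integrable by itself and can be moved into the
  drift, which becomes \<open>\<gamma>0\<close>; subtracting \<open>\<gamma>0 * s\<close> leaves the
  jump part.\<close>

lemma driftless_levy_law_marginal:
  assumes sets[measurable_cong, simp]: "sets \<nu> = sets borel" and int: "integrable \<nu> (\<lambda>x. min 1 \<bar>x\<bar>)"
    and s: "0 < s" and marg: "levy_marginal 0 \<gamma> \<nu> s M"
  defines "\<gamma>0 \<equiv> \<gamma> - (LINT x|\<nu>. x * indicator {-1..1} x)"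
  shows "driftless_levy_law \<nu> s (distr M borel (\<lambda>y. y - \<gamma>0 * s))"
proof -
  have M: "prob_space M" "sets M = sets borel"
      "char M u = exp (complex_of_real s * lk_exponent 0 \<gamma> \<nu> u)" for u
    using marg by (auto simp: levy_marginal_def)
  interpret M: real_distribution M
    using M by (simp add: real_distribution_def real_distribution_axioms_def)
  note dom = integrable_min_1_dominated[OF sets int]
  have char: "char (distr M borel (\<lambda>y. y - \<gamma>0 * s)) u
      = exp (complex_of_real s * (CLINT x|\<nu>. iexp (u * x) - 1))" for u
  proof -
    have i1: "integrable \<nu> (\<lambda>x. iexp (u * x) - 1)"
      by (rule dom[where C = "2 + \<bar>u\<bar>"]) (auto intro: norm_iexp_minus_1_le simp del: of_real_mult)
    have i2: "integrable \<nu> (\<lambda>x. \<i> * complex_of_real (u * x * indicator {-1..1} x))"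
      by (rule dom[where C = "\<bar>u\<bar>"]) (auto simp: norm_mult abs_mult indicator_def)
    have "(CLINT x|\<nu>. \<i> * complex_of_real (u * x * indicator {-1..1} x))
        = (CLINT x|\<nu>. (\<i> * complex_of_real u) * complex_of_real (x * indicator {-1..1} x))"
      by (simp add: mult.assoc)
    also have "\<dots> = (\<i> * complex_of_real u) * complex_of_real (LINT x|\<nu>. x * indicator {-1..1} x)"
      by (simp only: integral_mult_right_zero integral_complex_of_real)
    finally have comp: "(CLINT x|\<nu>. \<i> * complex_of_real (u * x * indicator {-1..1} x))
        = \<i> * complex_of_real u * complex_of_real (LINT x|\<nu>. x * indicator {-1..1} x)" .
    have lk: "lk_exponent 0 \<gamma> \<nu> u = \<i> * complex_of_real (\<gamma>0 * u) + (CLINT x|\<nu>. iexp (u * x) - 1)"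
      unfolding lk_exponent_def Bochner_Integration.integral_diff[OF i1 i2] comp
      by (simp add: \<gamma>0_def algebra_simps)
    have "char (distr M borel (\<lambda>y. y - \<gamma>0 * s)) u = (CLINT y|M. iexp (u * (y - \<gamma>0 * s)))"
      unfolding char_def by (subst integral_distr) auto
    also have "\<dots> = (CLINT y|M. iexp (- (u * \<gamma>0 * s)) * iexp (u * y))"
      by (simp add: exp_add[symmetric] algebra_simps)
    also have "\<dots> = iexp (- (u * \<gamma>0 * s)) * char M u"
      unfolding char_def by simp
    also have "\<dots> = exp (complex_of_real s * (CLINT x|\<nu>. iexp (u * x) - 1))"
      unfolding M(3) lk exp_add[symmetric] by (rule arg_cong[where f = exp]) (simp add: algebra_simps)
    finally show ?thesis .
  qed
  show ?thesis
    by (intro driftless_levy_law.intro sets int s char M.real_distribution_distr) simp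
qed

theorem theorem5p1:
  fixes \<sigma> \<gamma> :: real and \<nu> :: "real measure" and \<mu> :: "real \<Rightarrow> real measure"
    and T K r \<delta> :: real
  assumes levy: "levy_measure \<nu>"
    and marg: "\<And>s. 0 \<le> s \<Longrightarrow> levy_marginal \<sigma> \<gamma> \<nu> s (\<mu> s)"
    and T: "T > 0" and K: "K > 0" and r: "r > 0" and \<delta>: "\<delta> \<ge> 0"
    and expmom: "(\<integral>\<^sup>+ x. ennreal (exp x) * indicator {x. \<bar>x\<bar> \<ge> 1} x \<partial>\<nu>) < \<infinity>"
    and mart: "\<sigma>\<^sup>2 / 2 + \<gamma> + (LINT x|\<nu>. exp x - 1 - x * indicator {-1..1} x) = 0"
    and nondeg: "\<sigma> \<noteq> 0 \<or> emeasure \<nu> {..<0} > 0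
                 \<or> (\<integral>\<^sup>+ x. ennreal (min x 1) * indicator {0<..} x \<partial>\<nu>) = \<infinity>"
    and finvar: "\<sigma> = 0" "(\<integral>\<^sup>+ x. ennreal \<bar>x\<bar> * indicator {-1..1} x \<partial>\<nu>) < \<infinity>"
    and dplus: "r - \<delta> - (LINT y|\<nu>. max 0 (exp y - 1)) > 0"
  shows "((\<lambda>t. (K / euro_crit \<mu> r \<delta> K T t - 1) / (T - t))
           \<longlongrightarrow> (LINT y|\<nu>. max 0 (- (exp y - 1)))) (at_left T)"
proof -

  \<comment> \<open>Integrability with respect to \<nu>\<close>
  have sets[measurable_cong, simp]: "sets \<nu> = sets borel"
    using levy by (simp add: levy_measure_def)
  have fin: "(\<integral>\<^sup>+ x. ennreal (min 1 \<bar>x\<bar>) \<partial>\<nu>) < \<infinity>"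
  proof -
    have "(\<integral>\<^sup>+ x. ennreal (min 1 \<bar>x\<bar>) \<partial>\<nu>)
        \<le> (\<integral>\<^sup>+ x. ennreal \<bar>x\<bar> * indicator {-1..1} x + ennreal (min 1 (x\<^sup>2)) \<partial>\<nu>)"
    proof (rule nn_integral_mono)
      fix x :: real
      show "ennreal (min 1 \<bar>x\<bar>) \<le> ennreal \<bar>x\<bar> * indicator {-1..1} x + ennreal (min 1 (x\<^sup>2))"
      \<comment> \<open>Finite variation controls the jumps of size at most 1, the Levy measure
        condition controls the larger ones.\<close>
      proof (cases "\<bar>x\<bar> \<le> 1")
        case True
        then have "ennreal (min 1 \<bar>x\<bar>) = ennreal \<bar>x\<bar> * indicator {-1..1} x"
          by (simp add: indicator_def abs_le_iff)
        then show ?thesis by simp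
      next
        case False
        then have "1 \<le> x\<^sup>2" using one_le_power[of "\<bar>x\<bar>" 2] by simp
        then show ?thesis using False by (simp add: indicator_def)
      qed
    qed
    also have "\<dots> = (\<integral>\<^sup>+ x. ennreal \<bar>x\<bar> * indicator {-1..1} x \<partial>\<nu>) + (\<integral>\<^sup>+ x. ennreal (min 1 (x\<^sup>2)) \<partial>\<nu>)"
      by (rule nn_integral_add) auto
    also have "\<dots> < \<infinity>"
      using finvar(2) levy by (simp add: levy_measure_def)
    finally show ?thesis .
  qed
  have int: "integrable \<nu> (\<lambda>x. min 1 \<bar>x\<bar>)"
    using fin by (intro integrableI_bounded) auto
  note dom = integrable_min_1_dominated[OF sets int]
  have int_exp: "integrable \<nu> (\<lambda>x. exp x - 1)"
  proof (rule Bochner_Integration.integrable_bound)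
    have "ennreal (norm (exp x * indicator {x. 1 \<le> \<bar>x\<bar>} x))
        = ennreal (exp x) * indicator {x. 1 \<le> \<bar>x\<bar>} x" for x :: real
      by (simp add: indicator_def)
    then have "integrable \<nu> (\<lambda>x. exp x * indicator {x. 1 \<le> \<bar>x\<bar>} x)"
      using expmom by (intro integrableI_bounded) simp_all
    then show "integrable \<nu> (\<lambda>x. 2 * min 1 \<bar>x\<bar> + exp x * indicator {x. 1 \<le> \<bar>x\<bar>} x)"
      using int by simp
    show "AE x in \<nu>. norm (exp x - 1) \<le> norm (2 * min 1 \<bar>x\<bar> + exp x * indicator {x. 1 \<le> \<bar>x\<bar>} x)"
      using abs_exp_minus_1_le by (auto intro: order_trans[OF _ abs_ge_self])
  qed auto
  have int_loss: "integrable \<nu> loss"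
    using loss_le by (intro dom[where C = 1]) auto
  have int_comp: "integrable \<nu> (\<lambda>x. x * indicator {-1..1} x)"
    by (rule dom[where C = 1]) (auto simp: indicator_def)

  \<comment> \<open>The loss rate \<open>c\<close> and the drift \<open>D\<close> of the log
    spot\<close>
  define c where "c = (LINT x|\<nu>. loss x)"
  define k where "k = (LINT x|\<nu>. loss (- x))"
  define \<gamma>0 where "\<gamma>0 = \<gamma> - (LINT x|\<nu>. x * indicator {-1..1} x)"
  define D where "D = r - \<delta> + \<gamma>0"
  have c_eq: "(LINT y|\<nu>. max 0 (- (exp y - 1))) = c"
    by (simp add: c_def loss_def)
  \<comment> \<open>With \<open>\<sigma> = 0\<close> and positive jumps of finite variation,
    non-degeneracy leaves only the alternative of negative jumps.\<close>
  have "0 < emeasure \<nu> {..<0}"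
  proof -
    have "(\<integral>\<^sup>+ x. ennreal (min x 1) * indicator {0<..} x \<partial>\<nu>) \<le> (\<integral>\<^sup>+ x. ennreal (min 1 \<bar>x\<bar>) \<partial>\<nu>)"
      by (intro nn_integral_mono) (auto simp: indicator_def min.commute)
    with fin nondeg finvar(1) show ?thesis by auto
  qed
  then have c_pos: "0 < c"
    unfolding c_def by (rule loss_integral_pos[OF sets int_loss])
  \<comment> \<open>Since \<open>max 0 (exp y - 1) = (exp y - 1) + loss y\<close> and the martingale
    condition says that \<open>\<gamma>0\<close> cancels the integral of \<open>exp y - 1\<close>,
    \<open>D - c\<close> is the quantity assumed positive in \<open>dplus\<close>.\<close>
  have c_less_D: "c < D"
  proof -
    have "(LINT y|\<nu>. max 0 (exp y - 1)) = (LINT y|\<nu>. (exp y - 1) + loss y)"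
      by (intro Bochner_Integration.integral_cong) (auto simp: loss_def)
    also have "\<dots> = (LINT y|\<nu>. exp y - 1) + c"
      unfolding c_def by (rule Bochner_Integration.integral_add[OF int_exp int_loss])
    moreover have "\<gamma>0 + (LINT y|\<nu>. exp y - 1) = 0"
      using mart finvar(1) Bochner_Integration.integral_diff[OF int_exp int_comp] by (simp add: \<gamma>0_def)
    ultimately show ?thesis using dplus by (simp add: D_def)
  qed

  \<comment> \<open>The put price at spot \<open>K / (1 + \<rho> * s)\<close>\<close>
  define Z where "Z s = distr (\<mu> s) borel (\<lambda>y. y - \<gamma>0 * s)" for s
  have law: "driftless_levy_law \<nu> s (Z s)" if "0 < s" for s
    using driftless_levy_law_marginal[OF sets int that] marg[of s] that finvar(1)
    by (simp add: Z_def \<gamma>0_def)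
  have marg_prob: "prob_space (\<mu> s)" and marg_sets: "sets (\<mu> s) = sets borel" if "0 < s" for s
    using marg[of s] that by (auto simp: levy_marginal_def)

  \<comment> \<open>Started at \<open>K / (1 + \<rho> * s)\<close>, the log-ratio of terminal spot
    to strike is \<open>a \<rho> s\<close> plus the jump part, and \<open>W \<rho> s\<close> is the
    price in units of \<open>K\<close>.\<close>
  define a where "a \<rho> s = D * s - ln (1 + \<rho> * s)" for \<rho> s
  define W where "W \<rho> s = exp (- r * s) * (LINT z|Z s. loss (a \<rho> s + z))" for \<rho> s
  have put_eq: "euro_put \<mu> r \<delta> K T t (K / (1 + \<rho> * s)) = K * W \<rho> s"
    if "0 < s" "0 \<le> \<rho>" "s = T - t" for \<rho> s t
  proof -
    have [measurable_cong]: "sets (\<mu> s) = sets borel" by (rule marg_sets[OF \<open>0 < s\<close>])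
    have pos: "0 < 1 + \<rho> * s" using that by (simp add: add_pos_nonneg)
    have "max 0 (K - K / (1 + \<rho> * s) * exp ((r - \<delta>) * s + y)) = K * loss (a \<rho> s + (y - \<gamma>0 * s))" for y
    proof -
      have "exp (a \<rho> s + (y - \<gamma>0 * s)) = exp ((r - \<delta>) * s + y - ln (1 + \<rho> * s))"
        by (simp add: a_def D_def algebra_simps)
      also have "\<dots> = exp ((r - \<delta>) * s + y) / (1 + \<rho> * s)"
        using pos by (simp add: exp_diff)
      finally have "K - K / (1 + \<rho> * s) * exp ((r - \<delta>) * s + y) = K * (1 - exp (a \<rho> s + (y - \<gamma>0 * s)))"
        by (simp add: algebra_simps)
      then show ?thesis using K by (simp add: loss_def max_mult_distrib_left)
    qed
    then have "euro_put \<mu> r \<delta> K T t (K / (1 + \<rho> * s))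
        = exp (- r * s) * (K * (LINT y|\<mu> s. loss (a \<rho> s + (y - \<gamma>0 * s))))"
      using that(3) by (simp add: euro_put_def)
    also have "(LINT y|\<mu> s. loss (a \<rho> s + (y - \<gamma>0 * s))) = (LINT z|Z s. loss (a \<rho> s + z))"
      unfolding Z_def by (subst integral_distr) auto
    finally show ?thesis by (simp add: W_def)
  qed
  have gap: "K - K / (1 + \<rho> * s) = K * (\<rho> * s / (1 + \<rho> * s))" if "0 < s" "0 \<le> \<rho>" for \<rho> s
  proof -
    have "0 < 1 + \<rho> * s" using that by (simp add: add_pos_nonneg)
    then show ?thesis by (simp add: field_simps)
  qed
  \<comment> \<open>Nonnegativity combines \<open>ln (1 + u) \<le> u\<close> with
    \<open>\<rho> \<le> D\<close>: the drift carries the spot back to the strike or above.\<close>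
  have a_bounds: "0 \<le> a \<rho> s \<and> a \<rho> s \<le> D * s" if "0 < s" "0 \<le> \<rho>" "\<rho> \<le> D" for \<rho> s
  proof -
    have "0 \<le> \<rho> * s" "\<rho> * s \<le> D * s" using that by (auto intro: mult_right_mono)
    then show ?thesis using ln_add_one_self_le_self[of "\<rho> * s"] by (simp add: a_def)
  qed

  \<comment> \<open>Price against intrinsic value for small \<open>s\<close>\<close>
  have upper: "\<forall>\<^sub>F s in at_right 0. W \<rho> s \<le> \<rho> * s / (1 + \<rho> * s)" if \<rho>: "c < \<rho>" "\<rho> < D" for \<rho>
  proof -
    have "((\<lambda>s. c * (1 + \<rho> * s)) \<longlongrightarrow> c * (1 + \<rho> * 0)) (at_right 0)"
      by (intro tendsto_intros)
    \<comment> \<open>Multiplied by \<open>s / (1 + \<rho> * s)\<close>, this turns the price bound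
      \<open>W \<rho> s \<le> s * c\<close> into the claim.\<close>
    then have "\<forall>\<^sub>F s in at_right 0. c * (1 + \<rho> * s) < \<rho>"
      using \<rho> by (intro order_tendstoD(2)) auto
    with eventually_at_right_less[of 0] show ?thesis
    proof eventually_elim
      case (elim s)
      interpret driftless_levy_law \<nu> s "Z s" by (rule law[OF elim(1)])
      have pos: "0 < 1 + \<rho> * s" using elim c_pos \<rho> by (simp add: add_pos_pos)
      have "W \<rho> s \<le> 1 * (s * c)"
        unfolding W_def c_def
        using elim r \<rho> c_pos a_bounds[of s \<rho>] by (intro mult_mono shifted_loss_le) auto
      also have "\<dots> \<le> \<rho> * s / (1 + \<rho> * s)"
        using mult_left_mono[OF less_imp_le[OF elim(2)], of s] elim(1) pos
        by (simp add: pos_le_divide_eq mult_ac)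
      finally show ?case .
    qed
  qed

  have lower: "\<forall>\<^sub>F s in at_right 0. \<rho> * s / (1 + \<rho> * s) < W \<rho> s" if \<rho>: "0 < \<rho>" "\<rho> < c" for \<rho>
  proof -
    \<comment> \<open>The lower bound for \<open>W \<rho> s / s\<close> tends to \<open>c\<close>
      minus twice this integral, which must stay above \<rho>.\<close>
    obtain \<eta> where \<eta>: "0 < \<eta>" "(LINT x|\<nu>. min \<eta> (loss x)) < (c - \<rho>) / 2"
      using min_loss_integral_small[OF sets int, of "(c - \<rho>) / 2"] \<rho> by auto
    define I where "I = (LINT x|\<nu>. min \<eta> (loss x))"
    \<comment> \<open>A lower bound for \<open>W \<rho> s / s\<close>, with
      \<open>1 - exp (- s * c)\<close> replaced by the smaller \<open>s * c * exp (- s * c)\<close>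
      so that division by \<open>s\<close> leaves an expression continuous at 0.\<close>
    let ?low = "\<lambda>s. exp (- r * s) * (c * exp (- s * c) - 2 * I - c * (s * k) / \<eta>)"
    have "(?low \<longlongrightarrow> exp (- r * 0) * (c * exp (- 0 * c) - 2 * I - c * (0 * k) / \<eta>)) (at_right 0)"
      using \<eta> by (intro tendsto_intros) auto
    then have "\<forall>\<^sub>F s in at_right 0. \<rho> < ?low s"
      using \<eta> by (intro order_tendstoD(1)) (auto simp: I_def field_simps)
    moreover have "((\<lambda>s. D * s) \<longlongrightarrow> D * 0) (at_right 0)"
      by (intro tendsto_intros)
    \<comment> \<open>Keeps the shift \<open>a \<rho> s\<close> below \<eta>, as
      \<open>shifted_loss_ge\<close> requires.\<close>
    then have "\<forall>\<^sub>F s in at_right 0. D * s < \<eta>"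
      using \<eta> by (intro order_tendstoD(2)) auto
    ultimately show ?thesis using eventually_at_right_less[of 0]
    proof eventually_elim
      case (elim s)
      interpret driftless_levy_law \<nu> s "Z s" by (rule law[OF elim(3)])
      have "\<rho> * s / (1 + \<rho> * s) \<le> s * \<rho>"
        using \<rho> elim(3) by (simp add: divide_le_eq add_pos_pos mult_le_cancel_left1 mult.commute)
      also have "s * \<rho> < s * ?low s"
        using elim by (intro mult_strict_left_mono)
      also have "\<dots> = exp (- r * s) * (s * c * exp (- s * c) - 2 * s * I - s * c * (s * k) / \<eta>)"
        by (simp add: algebra_simps)
      also have "\<dots> \<le> exp (- r * s) * (1 - exp (- s * c) - 2 * s * I - s * c * (s * k) / \<eta>)"
      proof -
        have "(1 + s * c) * exp (- s * c) \<le> exp (s * c) * exp (- s * c)"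
          using exp_ge_add_one_self[of "s * c"] by (intro mult_right_mono) auto
        then have "s * c * exp (- s * c) \<le> 1 - exp (- s * c)"
          by (simp add: exp_add[symmetric] algebra_simps)
        then show ?thesis by (intro mult_left_mono) auto
      qed
      also have "\<dots> \<le> W \<rho> s"
        unfolding W_def c_def k_def I_def
        using a_bounds[of s \<rho>] elim \<rho> c_less_D \<eta> by (intro mult_left_mono shifted_loss_ge) auto
      finally show ?case .
    qed
  qed

  \<comment> \<open>Squeezing the critical price\<close>
  have sandwich: "\<forall>\<^sub>F t in at_left T.
      \<rho>1 \<le> (K / euro_crit \<mu> r \<delta> K T t - 1) / (T - t) \<and>
      (K / euro_crit \<mu> r \<delta> K T t - 1) / (T - t) \<le> \<rho>2"
    if \<rho>: "0 < \<rho>1" "\<rho>1 < c" "c < \<rho>2" "\<rho>2 < D" for \<rho>1 \<rho>2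
  proof -
    have "filterlim (\<lambda>t. T - t) (at_right 0) (at_left T)"
    proof (rule filterlim_at_withinI)
      have "((\<lambda>t. T - t) \<longlongrightarrow> T - T) (at_left T)" by (intro tendsto_intros)
      then show "((\<lambda>t. T - t) \<longlongrightarrow> 0) (at_left T)" by simp
      show "\<forall>\<^sub>F t in at_left T. T - t \<in> {0<..} - {0}"
        unfolding eventually_at_filter by simp
    qed
    note ev = eventually_compose_filterlim[OF _ this]
    from ev[OF lower[OF \<rho>(1,2)]] ev[OF upper[OF \<rho>(3,4)]] ev[OF eventually_at_right_less[of 0]]
    show ?thesis
    proof eventually_elim
      case (elim t)
      define s where "s = T - t"
      define b where "b = euro_crit \<mu> r \<delta> K T t"
      have s: "0 < s" using elim by (simp add: s_def)
      have pos: "0 < 1 + \<rho>1 * s" "0 < 1 + \<rho>2 * s"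
        using s \<rho> c_pos by (auto intro!: add_pos_pos mult_pos_pos)
      have above: "max 0 (K - K / (1 + \<rho>1 * s)) < euro_put \<mu> r \<delta> K T t (K / (1 + \<rho>1 * s))"
      proof -
        have "0 \<le> K * (\<rho>1 * s / (1 + \<rho>1 * s))" using pos \<rho> s K by simp
        moreover have "K * (\<rho>1 * s / (1 + \<rho>1 * s)) < K * W \<rho>1 s"
          using elim(1) K unfolding s_def by (intro mult_strict_left_mono)
        moreover have "0 \<le> \<rho>1" using \<rho> by simp
        ultimately show ?thesis
          unfolding put_eq[OF s \<open>0 \<le> \<rho>1\<close> s_def] gap[OF s \<open>0 \<le> \<rho>1\<close>] by linarith
      qed
      have b_le: "b \<le> K / (1 + \<rho>1 * s)"
        unfolding b_def using above K pos by (intro euro_crit_le) auto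
      have b_ge: "K / (1 + \<rho>2 * s) \<le> b"
        unfolding b_def
      \<comment> \<open>\<open>above\<close>, which gives the upper bound for \<open>b\<close>, also
        serves as the nonemptiness witness for the lower one.\<close>
      proof (rule euro_crit_ge[OF _ _ _ _ _ _ _ _ above])
        show "euro_put \<mu> r \<delta> K T t (K / (1 + \<rho>2 * s)) \<le> K - K / (1 + \<rho>2 * s)"
        proof -
          have "0 \<le> \<rho>2" using \<rho> c_pos by simp
          then show ?thesis
            using elim(2) K unfolding put_eq[OF s \<open>0 \<le> \<rho>2\<close> s_def] gap[OF s \<open>0 \<le> \<rho>2\<close>]
            by (intro mult_left_mono) (auto simp: s_def)
        qed
      qed (use s pos K r marg_prob[OF s] marg_sets[OF s] in \<open>auto simp: s_def\<close>)
      have "0 < K / (1 + \<rho>2 * s)" using K pos by simp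
      then have "0 < b" using b_ge by linarith
      then have "1 + \<rho>1 * s \<le> K / b" "K / b \<le> 1 + \<rho>2 * s"
        using b_le b_ge pos by (auto simp: field_simps)
      then have "\<rho>1 \<le> (K / b - 1) / s \<and> (K / b - 1) / s \<le> \<rho>2"
        using s by (simp add: pos_le_divide_eq pos_divide_le_eq)
      then show ?case by (simp add: b_def s_def)
    qed
  qed

  show ?thesis
    unfolding c_eq
  \<comment> \<open>The squeeze needs \<open>0 < \<rho>1\<close> and \<open>\<rho>2 < D\<close>,
    hence \<open>max 0 l\<close> and \<open>min u D\<close> below; \<open>0 < c < D\<close> leaves
    room for both.\<close>
  proof (rule order_tendstoI)
    fix l assume "l < c"
    then obtain \<rho>1 where "max 0 l < \<rho>1" "\<rho>1 < c" using c_pos dense[of "max 0 l" c] by auto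
    moreover obtain \<rho>2 where "c < \<rho>2" "\<rho>2 < D" using dense[OF c_less_D] by auto
    ultimately show "\<forall>\<^sub>F t in at_left T. l < (K / euro_crit \<mu> r \<delta> K T t - 1) / (T - t)"
      using sandwich[of \<rho>1 \<rho>2] by (auto elim!: eventually_mono)
  next
    fix u assume "c < u"
    then obtain \<rho>2 where "c < \<rho>2" "\<rho>2 < min u D" using c_less_D dense[of c "min u D"] by auto
    moreover obtain \<rho>1 where "0 < \<rho>1" "\<rho>1 < c" using dense[OF c_pos] by auto
    ultimately show "\<forall>\<^sub>F t in at_left T. (K / euro_crit \<mu> r \<delta> K T t - 1) / (T - t) < u"
      using sandwich[of \<rho>1 \<rho>2] by (auto elim!: eventually_mono)
  qed
qed

end
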